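(* Let $J\subseteq I$ be ideals in a commutative Noetherian ring $R$. Then the following statements are equivalent: (i) $J$ is a demotion of $I$; (ii) $W^{-1}J$ is a demotion of $W^{-1}I$ for every multiplicatively closed subset $W$ of $R$; (iii) $J_{\mathfrak{p}}$ is a demotion of $I_{\mathfrak{p}}$ for every prime ideal $\mathfrak{p}$ of $R$.
   Context: For ideals $J\subseteq I$ in a commutative Noetherian ring $R$, $J$ is a demotion of $I$ if $I^rJ^s=I^{r+s}\cap J^s$ for all integers $r,s\geq 0$ (with $I^0=J^0=R$). Here $W^{-1}I$ is the extension of $I$ to the localization $W^{-1}R$, and $I_{\mathfrak{p}}$ is the extension of $I$ to $R_{\mathfrak{p}}$. *)

theory Defs
  imports "HOL-Algebra.Algebra"
begin

section \<open>Localization of a commutative ring\<close>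

definition loc_rel :: "('a, 'b) ring_scheme \<Rightarrow> 'a set \<Rightarrow> (('a \<times> 'a) \<times> ('a \<times> 'a)) set"
  where "loc_rel R W = {((a, s), (b, t)). a \<in> carrier R \<and> s \<in> W \<and> b \<in> carrier R \<and> t \<in> W \<and>
           (\<exists>w\<in>W. w \<otimes>\<^bsub>R\<^esub> (a \<otimes>\<^bsub>R\<^esub> t \<ominus>\<^bsub>R\<^esub> b \<otimes>\<^bsub>R\<^esub> s) = \<zero>\<^bsub>R\<^esub>)}"

text \<open>The fraction \<open>a / s\<close>.\<close>

definition loc_frac :: "('a, 'b) ring_scheme \<Rightarrow> 'a set \<Rightarrow> 'a \<Rightarrow> 'a \<Rightarrow> ('a \<times> 'a) set"
  where "loc_frac R W a s = loc_rel R W `` {(a, s)}"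

text \<open>
  \<open>W\<^sup>-\<^sup>1R\<close>.  The set \<open>W\<close> is allowed to contain zero, in which case this is the zero ring.
  The unions in the operations are over all representatives of the two classes, as in
  \<^const>\<open>rcoset_mult\<close>; the operations do not depend on representatives
  (lemmas \<open>loc_mult_frac\<close> and \<open>loc_add_frac\<close>).
\<close>

definition localization :: "('a, 'b) ring_scheme \<Rightarrow> 'a set \<Rightarrow> ('a \<times> 'a) set ring"
  where "localization R W =
    \<lparr> carrier = (carrier R \<times> W) // loc_rel R W,
      monoid.mult = (\<lambda>A B. \<Union>(a, s)\<in>A. \<Union>(b, t)\<in>B.
               loc_frac R W (a \<otimes>\<^bsub>R\<^esub> b) (s \<otimes>\<^bsub>R\<^esub> t)),
      one = loc_frac R W \<one>\<^bsub>R\<^esub> \<one>\<^bsub>R\<^esub>,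
      ring.zero = loc_frac R W \<zero>\<^bsub>R\<^esub> \<one>\<^bsub>R\<^esub>,
      ring.add = (\<lambda>A B. \<Union>(a, s)\<in>A. \<Union>(b, t)\<in>B.
               loc_frac R W (a \<otimes>\<^bsub>R\<^esub> t \<oplus>\<^bsub>R\<^esub> b \<otimes>\<^bsub>R\<^esub> s) (s \<otimes>\<^bsub>R\<^esub> t)) \<rparr>"

text \<open>The extension \<open>W\<^sup>-\<^sup>1I\<close> of \<open>I\<close> along the canonical map \<open>a \<mapsto> a / 1\<close>.\<close>

definition loc_ideal :: "('a, 'b) ring_scheme \<Rightarrow> 'a set \<Rightarrow> 'a set \<Rightarrow> ('a \<times> 'a) set set"
  where "loc_ideal R W I = Idl\<^bsub>localization R W\<^esub> ((\<lambda>a. loc_frac R W a \<one>\<^bsub>R\<^esub>) ` I)"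

definition localization_at :: "('a, 'b) ring_scheme \<Rightarrow> 'a set \<Rightarrow> ('a \<times> 'a) set ring"
  where "localization_at R P = localization R (carrier R - P)"

definition loc_ideal_at :: "('a, 'b) ring_scheme \<Rightarrow> 'a set \<Rightarrow> 'a set \<Rightarrow> ('a \<times> 'a) set set"
  where "loc_ideal_at R P I = loc_ideal R (carrier R - P) I"


section \<open>Demotions\<close>

text \<open>
  Powers of ideals are taken in the monoid of ideals \<^const>\<open>ideals_set\<close>, whose unit is
  \<open>carrier R\<close>; in particular the zeroth power of an ideal is the whole ring.
\<close>

definition demotion :: "('a, 'b) ring_scheme \<Rightarrow> 'a set \<Rightarrow> 'a set \<Rightarrow> bool"
  where "demotion R J I \<longleftrightarrow> ideal J R \<and> ideal I R \<and> J \<subseteq> I \<and>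
    (\<forall>r s :: nat.
       (I [^]\<^bsub>ideals_set R\<^esub> r) \<cdot>\<^bsub>R\<^esub> (J [^]\<^bsub>ideals_set R\<^esub> s) =
       (I [^]\<^bsub>ideals_set R\<^esub> (r + s)) \<inter> (J [^]\<^bsub>ideals_set R\<^esub> s))"


section \<open>Well-definedness of the localization\<close>

context cring
begin

context
  fixes W
  assumes W: "submonoid W R"
begin

lemma loc_W [simp]:
  "s \<in> W \<Longrightarrow> s \<in> carrier R" "s \<in> W \<Longrightarrow> t \<in> W \<Longrightarrow> s \<otimes> t \<in> W" "\<one> \<in> W"
  using W by (auto simp: submonoid_def)

lemma loc_rel_iff:
  "((a, s), (b, t)) \<in> loc_rel R W \<longleftrightarrow> a \<in> carrier R \<and> s \<in> W \<and> b \<in> carrier R \<and> t \<in> W \<and>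
     (\<exists>w\<in>W. w \<otimes> (a \<otimes> t) = w \<otimes> (b \<otimes> s))"
proof -
  have "w \<otimes> (a \<otimes> t \<ominus> b \<otimes> s) = \<zero> \<longleftrightarrow> w \<otimes> (a \<otimes> t) = w \<otimes> (b \<otimes> s)"
    if "a \<in> carrier R" "b \<in> carrier R" "s \<in> W" "t \<in> W" "w \<in> W" for w
  proof -
    have "w \<otimes> (a \<otimes> t \<ominus> b \<otimes> s) = w \<otimes> (a \<otimes> t) \<ominus> w \<otimes> (b \<otimes> s)"
      using that by (simp add: minus_eq r_distr r_minus)
    then show ?thesis
      using that by simp
  qed
  then show ?thesis
    unfolding loc_rel_def by auto
qed

lemma loc_rel_equiv: "equiv (carrier R \<times> W) (loc_rel R W)"
proof (rule equivI)
  show "loc_rel R W \<subseteq> (carrier R \<times> W) \<times> (carrier R \<times> W)"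
    by (auto simp: loc_rel_iff)
  show "refl_on (carrier R \<times> W) (loc_rel R W)"
    by (rule refl_onI) (auto simp: loc_rel_iff intro: bexI[of _ \<one>])
  show "sym (loc_rel R W)"
    by (rule symI) (auto simp: loc_rel_iff, metis)
  show "trans (loc_rel R W)"
  proof (rule transI, clarify)
    fix a s b t c u
    assume 1: "((a, s), (b, t)) \<in> loc_rel R W" and 2: "((b, t), (c, u)) \<in> loc_rel R W"
    then have c: "a \<in> carrier R" "b \<in> carrier R" "c \<in> carrier R" "s \<in> W" "t \<in> W" "u \<in> W"
      by (auto simp: loc_rel_iff)
    obtain v where v: "v \<in> W" "v \<otimes> (a \<otimes> t) = v \<otimes> (b \<otimes> s)"
      using 1 by (auto simp: loc_rel_iff)
    obtain w where w: "w \<in> W" "w \<otimes> (b \<otimes> u) = w \<otimes> (c \<otimes> t)"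
      using 2 by (auto simp: loc_rel_iff)
    have "(v \<otimes> w \<otimes> t) \<otimes> (a \<otimes> u) = (v \<otimes> (a \<otimes> t)) \<otimes> (w \<otimes> u)"
      using c v(1) w(1) by (simp add: m_ac)
    also have "\<dots> = (w \<otimes> (b \<otimes> u)) \<otimes> (v \<otimes> s)"
      unfolding v(2) using c v(1) w(1) by (simp add: m_ac)
    also have "\<dots> = (v \<otimes> w \<otimes> t) \<otimes> (c \<otimes> s)"
      unfolding w(2) using c v(1) w(1) by (simp add: m_ac)
    finally show "((a, s), (c, u)) \<in> loc_rel R W"
      using c v(1) w(1) unfolding loc_rel_iff by (auto intro!: bexI[of _ "v \<otimes> w \<otimes> t"])
  qed
qed

lemma loc_frac_eq_iff:
  assumes "a \<in> carrier R" "s \<in> W" "b \<in> carrier R" "t \<in> W"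
  shows "loc_frac R W a s = loc_frac R W b t \<longleftrightarrow> (\<exists>w\<in>W. w \<otimes> (a \<otimes> t) = w \<otimes> (b \<otimes> s))"
  unfolding loc_frac_def using assms eq_equiv_class_iff[OF loc_rel_equiv, of "(a, s)" "(b, t)"]
  by (simp add: loc_rel_iff)

lemma loc_mult_congruent:
  "congruent2 (loc_rel R W) (loc_rel R W) (\<lambda>(a, s) (b, t). loc_frac R W (a \<otimes> b) (s \<otimes> t))"
proof (rule congruent2I', clarify)
  fix a s a' s' b t b' t'
  assume 1: "((a, s), (a', s')) \<in> loc_rel R W" and 2: "((b, t), (b', t')) \<in> loc_rel R W"
  then have c: "a \<in> carrier R" "s \<in> W" "a' \<in> carrier R" "s' \<in> W"
      "b \<in> carrier R" "t \<in> W" "b' \<in> carrier R" "t' \<in> W"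
    by (auto simp: loc_rel_iff)
  obtain v where v: "v \<in> W" "v \<otimes> (a \<otimes> s') = v \<otimes> (a' \<otimes> s)"
    using 1 by (auto simp: loc_rel_iff)
  obtain w where w: "w \<in> W" "w \<otimes> (b \<otimes> t') = w \<otimes> (b' \<otimes> t)"
    using 2 by (auto simp: loc_rel_iff)
  have "(v \<otimes> w) \<otimes> ((a \<otimes> b) \<otimes> (s' \<otimes> t')) = (v \<otimes> (a \<otimes> s')) \<otimes> (w \<otimes> (b \<otimes> t'))"
    using c v(1) w(1) by (simp add: m_ac)
  also have "\<dots> = (v \<otimes> w) \<otimes> ((a' \<otimes> b') \<otimes> (s \<otimes> t))"
    unfolding v(2) w(2) using c v(1) w(1) by (simp add: m_ac)
  finally show "loc_frac R W (a \<otimes> b) (s \<otimes> t) = loc_frac R W (a' \<otimes> b') (s' \<otimes> t')"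
    using c v(1) w(1) by (subst loc_frac_eq_iff) (auto intro!: bexI[of _ "v \<otimes> w"])
qed

lemma loc_add_congruent:
  "congruent2 (loc_rel R W) (loc_rel R W)
     (\<lambda>(a, s) (b, t). loc_frac R W (a \<otimes> t \<oplus> b \<otimes> s) (s \<otimes> t))"
proof (rule congruent2I', clarify)
  fix a s a' s' b t b' t'
  assume 1: "((a, s), (a', s')) \<in> loc_rel R W" and 2: "((b, t), (b', t')) \<in> loc_rel R W"
  then have c: "a \<in> carrier R" "s \<in> W" "a' \<in> carrier R" "s' \<in> W"
      "b \<in> carrier R" "t \<in> W" "b' \<in> carrier R" "t' \<in> W"
    by (auto simp: loc_rel_iff)
  obtain v where v: "v \<in> W" "v \<otimes> (a \<otimes> s') = v \<otimes> (a' \<otimes> s)"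
    using 1 by (auto simp: loc_rel_iff)
  obtain w where w: "w \<in> W" "w \<otimes> (b \<otimes> t') = w \<otimes> (b' \<otimes> t)"
    using 2 by (auto simp: loc_rel_iff)
  have "(v \<otimes> w) \<otimes> ((a \<otimes> t \<oplus> b \<otimes> s) \<otimes> (s' \<otimes> t')) =
      (v \<otimes> (a \<otimes> s')) \<otimes> (w \<otimes> t \<otimes> t') \<oplus> (w \<otimes> (b \<otimes> t')) \<otimes> (v \<otimes> s \<otimes> s')"
    using c v(1) w(1) by (simp add: m_ac l_distr r_distr)
  also have "\<dots> = (v \<otimes> w) \<otimes> ((a' \<otimes> t' \<oplus> b' \<otimes> s') \<otimes> (s \<otimes> t))"
    unfolding v(2) w(2) using c v(1) w(1) by (simp add: m_ac l_distr r_distr)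
  finally show "loc_frac R W (a \<otimes> t \<oplus> b \<otimes> s) (s \<otimes> t) =
      loc_frac R W (a' \<otimes> t' \<oplus> b' \<otimes> s') (s' \<otimes> t')"
    using c v(1) w(1) by (subst loc_frac_eq_iff) (auto intro!: bexI[of _ "v \<otimes> w"])
qed

lemma loc_mult_frac:
  assumes "a \<in> carrier R" "s \<in> W" "b \<in> carrier R" "t \<in> W"
  shows "loc_frac R W a s \<otimes>\<^bsub>localization R W\<^esub> loc_frac R W b t = loc_frac R W (a \<otimes> b) (s \<otimes> t)"
  using UN_equiv_class2[OF loc_rel_equiv loc_rel_equiv loc_mult_congruent, of "(a, s)" "(b, t)"] assms
  by (simp add: localization_def loc_frac_def[of _ _ a s] loc_frac_def[of _ _ b t] split_def)

lemma loc_add_frac: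
  assumes "a \<in> carrier R" "s \<in> W" "b \<in> carrier R" "t \<in> W"
  shows "loc_frac R W a s \<oplus>\<^bsub>localization R W\<^esub> loc_frac R W b t =
    loc_frac R W (a \<otimes> t \<oplus> b \<otimes> s) (s \<otimes> t)"
  using UN_equiv_class2[OF loc_rel_equiv loc_rel_equiv loc_add_congruent, of "(a, s)" "(b, t)"] assms
  by (simp add: localization_def loc_frac_def[of _ _ a s] loc_frac_def[of _ _ b t] split_def)

lemma loc_carrier:
  "carrier (localization R W) = {loc_frac R W a s | a s. a \<in> carrier R \<and> s \<in> W}"
  by (auto simp: localization_def loc_frac_def quotient_def)

lemma loc_frac_closed [simp]:
  "a \<in> carrier R \<Longrightarrow> s \<in> W \<Longrightarrow> loc_frac R W a s \<in> carrier (localization R W)"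
  by (auto simp: loc_carrier)

lemma loc_one: "\<one>\<^bsub>localization R W\<^esub> = loc_frac R W \<one> \<one>"
  and loc_zero: "\<zero>\<^bsub>localization R W\<^esub> = loc_frac R W \<zero> \<one>"
  by (simp_all add: localization_def)

lemma loc_frac_eqI:
  assumes "a \<in> carrier R" "s \<in> W" "b \<in> carrier R" "t \<in> W" "a \<otimes> t = b \<otimes> s"
  shows "loc_frac R W a s = loc_frac R W b t"
  using assms by (subst loc_frac_eq_iff) (auto intro!: bexI[of _ \<one>])

lemma loc_cring: "cring (localization R W)"
proof (rule cringI)
  show "abelian_group (localization R W)"
  proof (rule abelian_groupI)
    fix x assume "x \<in> carrier (localization R W)"
    then obtain a s where x: "x = loc_frac R W a s" "a \<in> carrier R" "s \<in> W"
      by (auto simp: loc_carrier)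
    then have "loc_frac R W (\<ominus> a) s \<oplus>\<^bsub>localization R W\<^esub> x = \<zero>\<^bsub>localization R W\<^esub>"
      by (simp add: loc_add_frac loc_zero l_minus l_neg) (rule loc_frac_eqI; simp)
    with x show "\<exists>y\<in>carrier (localization R W). y \<oplus>\<^bsub>localization R W\<^esub> x = \<zero>\<^bsub>localization R W\<^esub>"
      by (intro bexI[of _ "loc_frac R W (\<ominus> a) s"]) simp_all
  qed (fastforce simp: loc_carrier loc_add_frac loc_zero l_distr r_distr m_ac a_ac
        intro!: loc_frac_eqI)+
  show "comm_monoid (localization R W)"
    by (rule comm_monoidI)
      (fastforce simp: loc_carrier loc_mult_frac loc_one m_ac intro!: loc_frac_eqI)+
qed (clarsimp simp: loc_carrier loc_mult_frac loc_add_frac, rule loc_frac_eqI;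
      simp add: l_distr r_distr m_ac)

lemma loc_hom: "(\<lambda>a. loc_frac R W a \<one>) \<in> ring_hom R (localization R W)"
  by (rule ring_hom_memI) (simp_all add: loc_mult_frac loc_add_frac loc_one)

lemma loc_hom_Units:
  assumes "s \<in> W"
  shows "loc_frac R W s \<one> \<in> Units (localization R W)"
proof -
  have "loc_frac R W s \<one> \<otimes>\<^bsub>localization R W\<^esub> loc_frac R W \<one> s = \<one>\<^bsub>localization R W\<^esub>"
    using assms by (simp add: loc_mult_frac loc_one) (rule loc_frac_eqI; simp)
  moreover have "loc_frac R W \<one> s \<otimes>\<^bsub>localization R W\<^esub> loc_frac R W s \<one> = \<one>\<^bsub>localization R W\<^esub>"
    using assms by (simp add: loc_mult_frac loc_one) (rule loc_frac_eqI; simp)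
  ultimately show ?thesis
    using assms loc_frac_closed[OF one_closed assms] by (auto simp: Units_def)
qed

end

lemma loc_prime_complement:
  assumes "primeideal P R"
  shows "submonoid (carrier R - P) R"
proof -
  interpret P: primeideal P R by fact
  show ?thesis
    using P.I_prime P.I_notcarr P.one_imp_carrier by (unfold_locales) auto
qed

end

end

theory Submission
  imports Defs
begin

text \<open>
  An equality of ideals survives localization, and conversely can be checked at the prime ideals;
  the theorem applies this to the equalities \<open>I\<^sup>rJ\<^sup>s = I\<^sup>r\<^sup>+\<^sup>s \<inter> J\<^sup>s\<close> that define a demotion.

  The point is that extension of ideals along \<open>R \<rightarrow> W\<^sup>-\<^sup>1R\<close> commutes with each operation in those
  equalities: products (\<open>loc_ideal_prod\<close>), hence powers (\<open>loc_ideal_pow\<close>), and finite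
  intersections (\<open>loc_ideal_Int\<close>); the last fails for general ring homomorphisms.
  So both sides of the equality for \<open>W\<^sup>-\<^sup>1I\<close> and \<open>W\<^sup>-\<^sup>1J\<close> are the extensions of the two sides of the
  equality for \<open>I\<close> and \<open>J\<close>, and (i) implies (ii).  Localizations at primes are the special case
  \<open>W = R - P\<close>, so (ii) implies (iii).

  For (iii) implies (i), two ideals that agree at every prime are equal (\<open>ideal_eq_locally\<close>): if
  \<open>x\<close> lies in \<open>A\<close> but not in \<open>B\<close>, then the colon ideal \<open>(B : x)\<close> is proper, so it lies in a maximal
  ideal \<open>P\<close>, and \<open>x / 1\<close> cannot lie in \<open>B\<^sub>P\<close>, since no element outside \<open>P\<close> multiplies \<open>x\<close> into \<open>B\<close>.
\<close>

section \<open>Powers of ideals\<close>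

context cring
begin

lemma ideals_set_one: "\<one>\<^bsub>ideals_set R\<^esub> = carrier R"
  and ideals_set_mult: "I \<otimes>\<^bsub>ideals_set R\<^esub> J = I \<cdot> J"
  by (simp_all add: ideals_set_def)

lemma ideal_pow_is_ideal:
  assumes "ideal I R"
  shows "ideal (I [^]\<^bsub>ideals_set R\<^esub> (n::nat)) R"
  by (induction n) (simp_all add: ideals_set_one ideals_set_mult oneideal ideal_prod_is_ideal assms)


section \<open>Extension of ideals to a localization\<close>

context
  fixes W
  assumes W: "submonoid W R"
begin

interpretation L: cring "localization R W"
  by (rule loc_cring[OF W])

declare loc_W[OF W, simp] loc_frac_closed[OF W, simp]

text \<open>
  Fractions with numerator in \<open>I\<close> already form an ideal, because two of them can be brought to a
  common denominator; so no sums are needed to generate \<open>W\<^sup>-\<^sup>1I\<close>.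
\<close>

lemma loc_ideal_eq:
  assumes I: "ideal I R"
  shows "loc_ideal R W I = {loc_frac R W a s | a s. a \<in> I \<and> s \<in> W}" (is "_ = ?F")
proof
  interpret I: ideal I R by fact
  have "ideal ?F (localization R W)"
  proof (rule idealI)
    show "subgroup ?F (add_monoid (localization R W))"
    proof (rule L.add.subgroupI)
      show "?F \<noteq> {}"
        using I.zero_closed by (blast intro: loc_W(3)[OF W])
      fix x assume "x \<in> ?F"
      then obtain a s where x: "x = loc_frac R W a s" "a \<in> I" "s \<in> W"
        by blast
      have "loc_frac R W (\<ominus> a) s \<oplus>\<^bsub>localization R W\<^esub> x = \<zero>\<^bsub>localization R W\<^esub>"
        using x by (simp add: loc_add_frac[OF W] loc_zero[OF W] l_minus l_neg I.Icarr)
          (rule loc_frac_eqI[OF W]; simp)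
      then have "\<ominus>\<^bsub>localization R W\<^esub> x = loc_frac R W (\<ominus> a) s"
        using x by (intro L.minus_equality) (simp_all add: I.Icarr)
      then show "\<ominus>\<^bsub>localization R W\<^esub> x \<in> ?F"
        using x by auto
      fix y assume "y \<in> ?F"
      then obtain b t where y: "y = loc_frac R W b t" "b \<in> I" "t \<in> W"
        by blast
      have "x \<oplus>\<^bsub>localization R W\<^esub> y = loc_frac R W (a \<otimes> t \<oplus> b \<otimes> s) (s \<otimes> t)"
        using x y by (simp add: loc_add_frac[OF W] I.Icarr)
      moreover have "a \<otimes> t \<oplus> b \<otimes> s \<in> I"
        using x y by (simp add: I.I_r_closed)
      moreover have "s \<otimes> t \<in> W"
        using x y by simp
      ultimately show "x \<oplus>\<^bsub>localization R W\<^esub> y \<in> ?F"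
        by blast
    qed (auto simp: I.Icarr)
  next
    fix x y assume "x \<in> ?F" "y \<in> carrier (localization R W)"
    then obtain a s b t where *: "x = loc_frac R W a s" "a \<in> I" "s \<in> W"
        "y = loc_frac R W b t" "b \<in> carrier R" "t \<in> W"
      by (auto simp: loc_carrier[OF W])
    then have "y \<otimes>\<^bsub>localization R W\<^esub> x = loc_frac R W (b \<otimes> a) (t \<otimes> s)"
        "x \<otimes>\<^bsub>localization R W\<^esub> y = loc_frac R W (a \<otimes> b) (s \<otimes> t)"
      by (simp_all add: loc_mult_frac[OF W] I.Icarr)
    moreover have "b \<otimes> a \<in> I" "a \<otimes> b \<in> I" "t \<otimes> s \<in> W" "s \<otimes> t \<in> W"
      using * by (simp_all add: I.I_l_closed I.I_r_closed)
    ultimately show "y \<otimes>\<^bsub>localization R W\<^esub> x \<in> ?F" "x \<otimes>\<^bsub>localization R W\<^esub> y \<in> ?F"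
      by blast+
  qed (rule L.ring_axioms)
  then show "loc_ideal R W I \<subseteq> ?F"
    unfolding loc_ideal_def by (rule L.genideal_minimal) (use loc_W(3)[OF W] in blast)
  show "?F \<subseteq> loc_ideal R W I"
  proof clarify
    fix a s assume as: "a \<in> I" "s \<in> W"
    have sub: "(\<lambda>a. loc_frac R W a \<one>) ` I \<subseteq> carrier (localization R W)"
      by (auto simp: I.Icarr)
    have "loc_frac R W a \<one> \<in> loc_ideal R W I"
      using L.genideal_self[OF sub] as unfolding loc_ideal_def by blast
    then have "loc_frac R W \<one> s \<otimes>\<^bsub>localization R W\<^esub> loc_frac R W a \<one> \<in> loc_ideal R W I"
      using as unfolding loc_ideal_def by (intro ideal.I_l_closed[OF L.genideal_ideal[OF sub]]) simp_all
    then show "loc_frac R W a s \<in> loc_ideal R W I"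
      using as by (simp add: loc_mult_frac[OF W] I.Icarr)
  qed
qed

lemma loc_ideal_is_ideal:
  assumes "ideal I R"
  shows "ideal (loc_ideal R W I) (localization R W)"
  unfolding loc_ideal_def
  by (rule L.genideal_ideal) (use ideal.Icarr[OF assms] in auto)

lemma loc_ideal_memI:
  assumes "ideal I R" "a \<in> I" "s \<in> W"
  shows "loc_frac R W a s \<in> loc_ideal R W I"
  using assms by (auto simp: loc_ideal_eq)

lemma loc_ideal_mono:
  assumes "ideal I R" "ideal J R" "J \<subseteq> I"
  shows "loc_ideal R W J \<subseteq> loc_ideal R W I"
  using assms by (auto simp: loc_ideal_eq)

text \<open>
  The numerator of a fraction in \<open>W\<^sup>-\<^sup>1I\<close> need not lie in \<open>I\<close>; equality of fractions
  costs a factor from \<open>W\<close>.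
\<close>

lemma loc_frac_mem_loc_ideal_iff:
  assumes I: "ideal I R" and x: "x \<in> carrier R" "s \<in> W"
  shows "loc_frac R W x s \<in> loc_ideal R W I \<longleftrightarrow> (\<exists>w\<in>W. w \<otimes> x \<in> I)"
proof
  interpret I: ideal I R by fact
  assume "loc_frac R W x s \<in> loc_ideal R W I"
  then obtain a t where a: "a \<in> I" "t \<in> W" and "loc_frac R W x s = loc_frac R W a t"
    by (auto simp: loc_ideal_eq[OF I])
  then obtain w where w: "w \<in> W" "w \<otimes> (x \<otimes> t) = w \<otimes> (a \<otimes> s)"
    using x by (auto simp: loc_frac_eq_iff[OF W] I.Icarr)
  have "(w \<otimes> t) \<otimes> x = w \<otimes> (x \<otimes> t)"
    using a w(1) x by (simp add: m_ac)
  also have "\<dots> \<in> I"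
    unfolding w(2) using a w(1) x by (simp add: I.I_l_closed I.I_r_closed)
  finally show "\<exists>w\<in>W. w \<otimes> x \<in> I"
    using a w(1) by (intro bexI[of _ "w \<otimes> t"]) simp_all
next
  assume "\<exists>w\<in>W. w \<otimes> x \<in> I"
  then obtain w where w: "w \<in> W" "w \<otimes> x \<in> I"
    by blast
  have "loc_frac R W x s = loc_frac R W (w \<otimes> x) (w \<otimes> s)"
    using w(1) x by (intro loc_frac_eqI[OF W]) (simp_all add: m_ac)
  also have "\<dots> \<in> loc_ideal R W I"
    using w x by (intro loc_ideal_memI[OF I]) simp_all
  finally show "loc_frac R W x s \<in> loc_ideal R W I" .
qed

lemma loc_ideal_carrier: "loc_ideal R W (carrier R) = carrier (localization R W)"
  by (simp add: loc_ideal_eq[OF oneideal] loc_carrier[OF W])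

lemma loc_ideal_prod:
  assumes I: "ideal I R" and J: "ideal J R"
  shows "loc_ideal R W (I \<cdot> J) = loc_ideal R W I \<cdot>\<^bsub>localization R W\<^esub> loc_ideal R W J"
proof
  interpret I: ideal I R by fact
  interpret J: ideal J R by fact
  note IJ = ideal_prod_is_ideal[OF I J]
  note lIJ = L.ideal_prod_is_ideal[OF loc_ideal_is_ideal[OF I] loc_ideal_is_ideal[OF J]]
  have "loc_frac R W x \<one> \<in> loc_ideal R W I \<cdot>\<^bsub>localization R W\<^esub> loc_ideal R W J"
    if "x \<in> I \<cdot> J" for x
    using that
  proof induction
    case (prod a b)
    then have "loc_frac R W (a \<otimes> b) \<one> =
        loc_frac R W a \<one> \<otimes>\<^bsub>localization R W\<^esub> loc_frac R W b \<one>"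
      by (simp add: loc_mult_frac[OF W] I.Icarr J.Icarr)
    with prod show ?case
      by (simp add: ideal_prod.prod loc_ideal_memI I J)
  next
    case (sum x y)
    then have "loc_frac R W (x \<oplus> y) \<one> =
        loc_frac R W x \<one> \<oplus>\<^bsub>localization R W\<^esub> loc_frac R W y \<one>"
      by (simp add: loc_add_frac[OF W] ideal.Icarr[OF IJ])
    with sum show ?case
      by (simp add: ideal_prod.sum)
  qed
  then show "loc_ideal R W (I \<cdot> J) \<subseteq> loc_ideal R W I \<cdot>\<^bsub>localization R W\<^esub> loc_ideal R W J"
    unfolding loc_ideal_def[of R W "I \<cdot> J"] by (intro L.genideal_minimal[OF lIJ]) blast
  show "loc_ideal R W I \<cdot>\<^bsub>localization R W\<^esub> loc_ideal R W J \<subseteq> loc_ideal R W (I \<cdot> J)"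
  proof
    fix z assume "z \<in> loc_ideal R W I \<cdot>\<^bsub>localization R W\<^esub> loc_ideal R W J"
    then show "z \<in> loc_ideal R W (I \<cdot> J)"
    proof induction
      case (prod x y)
      then obtain a s b t where "x = loc_frac R W a s" "a \<in> I" "s \<in> W"
          "y = loc_frac R W b t" "b \<in> J" "t \<in> W"
        by (auto simp: loc_ideal_eq I J)
      then show ?case
        by (auto simp: loc_mult_frac[OF W] I.Icarr J.Icarr intro!: loc_ideal_memI[OF IJ]
            intro: ideal_prod.prod)
    next
      case (sum x y)
      then show ?case
        by (intro additive_subgroup.a_closed[OF ideal.axioms(1)[OF loc_ideal_is_ideal[OF IJ]]])
    qed
  qed
qed

lemma loc_ideal_pow:
  assumes "ideal I R"
  shows "loc_ideal R W (I [^]\<^bsub>ideals_set R\<^esub> (n::nat)) =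
    loc_ideal R W I [^]\<^bsub>ideals_set (localization R W)\<^esub> n"
  by (induction n)
    (simp_all add: ideals_set_one L.ideals_set_one ideals_set_mult L.ideals_set_mult
      loc_ideal_carrier loc_ideal_prod ideal_pow_is_ideal assms)

text \<open>
  If \<open>a / s\<close> with \<open>a\<close> in \<open>I\<close> also lies in \<open>W\<^sup>-\<^sup>1J\<close>, some \<open>w\<close> in \<open>W\<close> brings \<open>a\<close> into \<open>J\<close>, and \<open>w a\<close>
  is still in \<open>I\<close>.
\<close>

lemma loc_ideal_Int:
  assumes I: "ideal I R" and J: "ideal J R"
  shows "loc_ideal R W (I \<inter> J) = loc_ideal R W I \<inter> loc_ideal R W J"
proof
  note IJ = i_intersect[OF I J]
  show "loc_ideal R W (I \<inter> J) \<subseteq> loc_ideal R W I \<inter> loc_ideal R W J"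
    using loc_ideal_mono[OF I IJ] loc_ideal_mono[OF J IJ] by blast
  show "loc_ideal R W I \<inter> loc_ideal R W J \<subseteq> loc_ideal R W (I \<inter> J)"
  proof
    fix x assume x: "x \<in> loc_ideal R W I \<inter> loc_ideal R W J"
    then obtain a s where a: "x = loc_frac R W a s" "a \<in> I" "s \<in> W"
      by (auto simp: loc_ideal_eq[OF I])
    then have "a \<in> carrier R"
      by (simp add: ideal.Icarr[OF I])
    with x a obtain w where "w \<in> W" "w \<otimes> a \<in> J"
      by (auto simp: loc_frac_mem_loc_ideal_iff[OF J])
    moreover from this have "w \<otimes> a \<in> I"
      using a by (simp add: ideal.I_l_closed[OF I])
    ultimately show "x \<in> loc_ideal R W (I \<inter> J)"
      using a \<open>a \<in> carrier R\<close> by (auto simp: loc_frac_mem_loc_ideal_iff[OF IJ])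
  qed
qed

lemma loc_ideal_demotion_sides:
  assumes "ideal I R" "ideal J R"
  shows "loc_ideal R W ((I [^]\<^bsub>ideals_set R\<^esub> (r::nat)) \<cdot> (J [^]\<^bsub>ideals_set R\<^esub> (s::nat))) =
      (loc_ideal R W I [^]\<^bsub>ideals_set (localization R W)\<^esub> r) \<cdot>\<^bsub>localization R W\<^esub>
      (loc_ideal R W J [^]\<^bsub>ideals_set (localization R W)\<^esub> s)"
    and "loc_ideal R W ((I [^]\<^bsub>ideals_set R\<^esub> (r + s)) \<inter> (J [^]\<^bsub>ideals_set R\<^esub> s)) =
      (loc_ideal R W I [^]\<^bsub>ideals_set (localization R W)\<^esub> (r + s)) \<inter>
      (loc_ideal R W J [^]\<^bsub>ideals_set (localization R W)\<^esub> s)"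
  using assms by (simp_all add: loc_ideal_prod loc_ideal_Int loc_ideal_pow ideal_pow_is_ideal)

lemma demotion_localization:
  assumes "demotion R J I"
  shows "demotion (localization R W) (loc_ideal R W J) (loc_ideal R W I)"
proof -
  have I: "ideal I R" and J: "ideal J R" and "J \<subseteq> I"
    using assms by (auto simp: demotion_def)
  with assms show ?thesis
    by (simp add: demotion_def loc_ideal_is_ideal loc_ideal_mono
        flip: loc_ideal_demotion_sides[OF I J])
qed

end


section \<open>Equality of ideals is a local property\<close>

text \<open>
  Zorn's lemma for the proper ideals containing \<open>I\<close>: the union of a chain of them is an ideal,
  and it is proper because it omits \<open>\<one>\<close>.
\<close>

lemma proper_ideal_subset_maximalideal:
  assumes I: "ideal I R" and "\<one> \<notin> I"
  obtains M where "maximalideal M R" "I \<subseteq> M"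
proof -
  let ?A = "{K. ideal K R \<and> I \<subseteq> K \<and> \<one> \<notin> K}"
  have "\<exists>M\<in>?A. \<forall>K\<in>?A. M \<subseteq> K \<longrightarrow> K = M"
  proof (rule subset_Zorn_nonempty)
    show "?A \<noteq> {}"
      using assms by blast
    fix C assume C: "C \<noteq> {}" "subset.chain ?A C"
    then have "subset.chain {K. ideal K R} C"
      by (auto simp: pred_on.chain_def)
    then have "ideal (\<Union>C) R"
      using chain_Union_is_ideal[of C] C(1) by simp
    then show "\<Union>C \<in> ?A"
      using C by (auto simp: pred_on.chain_def)
  qed
  then obtain M where M: "ideal M R" "I \<subseteq> M" "\<one> \<notin> M"
    and max: "\<And>K. ideal K R \<Longrightarrow> I \<subseteq> K \<Longrightarrow> \<one> \<notin> K \<Longrightarrow> M \<subseteq> K \<Longrightarrow> K = M"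
    by auto
  have "maximalideal M R"
  proof (rule maximalidealI)
    show "carrier R \<noteq> M"
      using M(3) by blast
    fix K assume "ideal K R" "M \<subseteq> K"
    then show "K = M \<or> K = carrier R"
      using max[of K] M(2) ideal.one_imp_carrier[of K R] by blast
  qed (rule M)
  then show thesis
    using that M(2) by blast
qed

lemma ideal_subset_locally:
  assumes A: "ideal A R" and B: "ideal B R"
    and le: "\<And>P. primeideal P R \<Longrightarrow> loc_ideal_at R P A \<subseteq> loc_ideal_at R P B"
  shows "A \<subseteq> B"
proof
  fix x assume x: "x \<in> A"
  then have xR: "x \<in> carrier R"
    by (rule ideal.Icarr[OF A])
  \<comment> \<open>the colon ideal \<open>(B : x)\<close>\<close>
  let ?Q = "{y \<in> carrier R. x \<otimes> y \<in> B}"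
  have Q: "ideal ?Q R"
    by (rule ideal.helper_max_prime[OF B is_cring xR])
  have "\<one> \<in> ?Q"
  proof (rule ccontr)
    assume "\<one> \<notin> ?Q"
    then obtain P where "maximalideal P R" and QP: "?Q \<subseteq> P"
      by (rule proper_ideal_subset_maximalideal[OF Q])
    then have P: "primeideal P R"
      by (intro maximalideal_prime)
    note W = loc_prime_complement[OF P]
    have one: "\<one> \<in> carrier R - P"
      by (rule loc_W(3)[OF W])
    have "loc_frac R (carrier R - P) x \<one> \<in> loc_ideal R (carrier R - P) B"
      using le[OF P] loc_ideal_memI[OF W A x one] by (auto simp: loc_ideal_at_def)
    then obtain w where "w \<in> carrier R - P" "w \<otimes> x \<in> B"
      by (auto simp: loc_frac_mem_loc_ideal_iff[OF W B xR one])
    then show False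
      using QP xR by (auto simp: m_comm)
  qed
  then show "x \<in> B"
    using xR by simp
qed

lemma ideal_eq_locally:
  assumes "ideal A R" "ideal B R"
    and "\<And>P. primeideal P R \<Longrightarrow> loc_ideal_at R P A = loc_ideal_at R P B"
  shows "A = B"
  using ideal_subset_locally[of A B] ideal_subset_locally[of B A] assms by blast

lemma demotion_if_demotion_at_primes:
  assumes I: "ideal I R" and J: "ideal J R" and "J \<subseteq> I"
    and dem: "\<And>P. primeideal P R \<Longrightarrow>
      demotion (localization_at R P) (loc_ideal_at R P J) (loc_ideal_at R P I)"
  shows "demotion R J I"
  unfolding demotion_def
proof (intro conjI allI)
  fix r s :: nat
  show "(I [^]\<^bsub>ideals_set R\<^esub> r) \<cdot> (J [^]\<^bsub>ideals_set R\<^esub> s) =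
      (I [^]\<^bsub>ideals_set R\<^esub> (r + s)) \<inter> (J [^]\<^bsub>ideals_set R\<^esub> s)"
  proof (rule ideal_eq_locally)
    fix P assume P: "primeideal P R"
    show "loc_ideal_at R P ((I [^]\<^bsub>ideals_set R\<^esub> r) \<cdot> (J [^]\<^bsub>ideals_set R\<^esub> s)) =
        loc_ideal_at R P ((I [^]\<^bsub>ideals_set R\<^esub> (r + s)) \<inter> (J [^]\<^bsub>ideals_set R\<^esub> s))"
      using dem[OF P]
      by (simp add: demotion_def loc_ideal_at_def localization_at_def
          loc_ideal_demotion_sides[OF loc_prime_complement[OF P] I J])
  qed (simp_all add: ideal_prod_is_ideal i_intersect ideal_pow_is_ideal I J)
qed (use assms in simp_all)

end


section \<open>The equivalences\<close>

theorem proposition3p1: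
  fixes R :: "('a, 'b) ring_scheme" (structure)
    and I J :: "'a set"
  assumes "cring R" and "noetherian_ring R"
    and "ideal I R" and "ideal J R" and "J \<subseteq> I"
  shows "(demotion R J I \<longleftrightarrow>
            (\<forall>W. submonoid W R \<longrightarrow>
               demotion (localization R W) (loc_ideal R W J) (loc_ideal R W I))) \<and>
         (demotion R J I \<longleftrightarrow>
            (\<forall>P. primeideal P R \<longrightarrow>
               demotion (localization_at R P) (loc_ideal_at R P J) (loc_ideal_at R P I)))"
proof -
  interpret cring R by fact
  let ?i = "demotion R J I"
  let ?ii = "\<forall>W. submonoid W R \<longrightarrow>
    demotion (localization R W) (loc_ideal R W J) (loc_ideal R W I)"
  let ?iii = "\<forall>P. primeideal P R \<longrightarrow>
    demotion (localization_at R P) (loc_ideal_at R P J) (loc_ideal_at R P I)"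
  have "?i \<Longrightarrow> ?ii"
    by (simp add: demotion_localization)
  moreover have "?ii \<Longrightarrow> ?iii"
    by (simp add: localization_at_def loc_ideal_at_def loc_prime_complement)
  moreover have "?iii \<Longrightarrow> ?i"
    using assms by (intro demotion_if_demotion_at_primes) simp_all
  ultimately show ?thesis
    by blast
qed

end
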